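(* Let $\lambda$ be a nonzero real number, $k\in\mathbb{Z}$, and let $Y$ be a random variable whose moment generating function $E[e^{Yt}]$ exists for $|t|<r$ for some $r>0$. For every positive integer $n$, $$\sum_{l=1}^{n}S_{1,\lambda}(n,l)\,\mathrm{Bel}_{l,\lambda}^{(k,Y)}(x)=\sum_{j=1}^{n}\sum_{l=1}^{j}\frac{(1)_{l,\lambda}}{l^{k-1}}{j \brace l}_{Y}S_{1}(n,j)\,x^{l}.$$
   Context: Degenerate falling factorial: $(x)_{0,\lambda}=1$, $(x)_{n,\lambda}=x(x-\lambda)\cdots(x-(n-1)\lambda)$ for $n\ge1$. Degenerate exponential: $e_\lambda^x(t)=(1+\lambda t)^{x/\lambda}=\sum_{n\ge0}(x)_{n,\lambda}\frac{t^n}{n!}$. For $k\in\mathbb{Z}$, $\mathrm{Ei}_{k,\lambda}(x)=\sum_{n=1}^{\infty}\frac{(1)_{n,\lambda}}{(n-1)!\,n^{k}}x^{n}$. The probabilistic degenerate poly-Bell polynomials $\mathrm{Bel}_{n,\lambda}^{(k,Y)}(x)$ are defined by $\mathrm{Ei}_{k,\lambda}\big(x(E[e_\lambda^Y(t)]-1)\big)=\sum_{n=1}^{\infty}\mathrm{Bel}_{n,\lambda}^{(k,Y)}(x)\frac{t^n}{n!}$ (power series in $t$), with $\mathrm{Bel}_{0,\lambda}^{(k,Y)}(x)=1$. $S_1(n,k)$ are the (signed) Stirling numbers of the first kind: $(x)_n=x(x-1)\cdots(x-n+1)=\sum_{k=0}^nS_1(n,k)x^k$. The degenerate logarithm is $\log_\lambda(1+t)=\frac{1}{\lambda}((1+t)^\lambda-1)$,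 and the degenerate Stirling numbers of the first kind are defined by $\frac{1}{k!}(\log_\lambda(1+t))^k=\sum_{n\ge k}S_{1,\lambda}(n,k)\frac{t^n}{n!}$. The probabilistic Stirling numbers of the second kind associated with $Y$ are defined by $\frac{1}{k!}\big(E[e^{Yt}]-1\big)^k=\sum_{n\ge k}{n \brace k}_{Y}\frac{t^n}{n!}$ for $k\ge0$. *)

theory Defs
  imports "HOL-Probability.Probability"
begin

text \<open>
  \<open>egf_coeff f\<close> is the sequence \<open>a\<close> with \<open>f t = (\<Sum>n. a n * t ^ n / n!)\<close> for all \<open>t\<close> near 0.
  Such a sequence is unique if it exists (lemma \<open>egf_coeff_eqI\<close>).
\<close>

definition egf_coeff :: "(real \<Rightarrow> real) \<Rightarrow> nat \<Rightarrow> real" where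
  "egf_coeff f = (THE a. f has_fps_expansion Abs_fps (\<lambda>n. a n / fact n))"

lemma real_fps_nth_conv_deriv:
  fixes F :: "real fps"
  assumes "fps_conv_radius F > 0"
  shows "fps_nth F n = (deriv ^^ n) (eval_fps F) 0 / fact n"
  using assms
proof (induction n arbitrary: F)
  case 0
  then show ?case by (simp add: eval_fps_at_0)
next
  case (Suc n F)
  have "eventually (\<lambda>z::real. z \<in> eball 0 (fps_conv_radius F)) (nhds 0)"
    using Suc.prems by (intro eventually_nhds_in_open) (auto simp: zero_ereal_def)
  then have "eventually (\<lambda>z. deriv (eval_fps F) z = eval_fps (fps_deriv F) z) (nhds 0)"
    by eventually_elim (auto intro!: DERIV_imp_deriv has_field_derivative_eval_fps)
  then have "(deriv ^^ n) (deriv (eval_fps F)) 0 = (deriv ^^ n) (eval_fps (fps_deriv F)) 0"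
    by (intro higher_deriv_cong_ev refl)
  also have "\<dots> / fact n = fps_nth (fps_deriv F) n"
    using Suc.prems fps_conv_radius_deriv[of F] by (intro Suc.IH[symmetric]) auto
  also have "\<dots> = real (Suc n) * fps_nth F (Suc n)"
    by (simp add: fps_deriv_def)
  finally show ?case
    by (simp add: divide_simps funpow_Suc_right ac_simps del: funpow.simps of_nat_Suc)
qed

lemma egf_coeff_eqI:
  assumes "f has_fps_expansion Abs_fps (\<lambda>n. a n / fact n)"
  shows "egf_coeff f = a"
proof -
  have deriv: "b n = (deriv ^^ n) f 0"
    if b: "f has_fps_expansion Abs_fps (\<lambda>n. b n / fact n)" for b :: "nat \<Rightarrow> real" and n
  proof -
    let ?F = "Abs_fps (\<lambda>n. b n / fact n)"
    have "fps_nth ?F n = (deriv ^^ n) (eval_fps ?F) 0 / fact n"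
      using b by (intro real_fps_nth_conv_deriv) (auto simp: has_fps_expansion_def)
    also have "(deriv ^^ n) (eval_fps ?F) 0 = (deriv ^^ n) f 0"
      using b by (intro higher_deriv_cong_ev) (auto simp: has_fps_expansion_def)
    finally show ?thesis by simp
  qed
  have "b = a" if "f has_fps_expansion Abs_fps (\<lambda>n. b n / fact n)" for b
    using deriv[OF that] deriv[OF assms] by auto
  with assms show ?thesis
    unfolding egf_coeff_def by blast
qed

definition deg_falling :: "real \<Rightarrow> real \<Rightarrow> nat \<Rightarrow> real" where
  "deg_falling lam x n = (\<Prod>i<n. x - real i * lam)"

definition deg_exp :: "real \<Rightarrow> real \<Rightarrow> real \<Rightarrow> real" where
  "deg_exp lam x t = (1 + lam * t) powr (x / lam)"

text \<open>\<open>deg_log lam t\<close> stands for the degenerate logarithm of \<open>1 + t\<close>.\<close>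

definition deg_log :: "real \<Rightarrow> real \<Rightarrow> real" where
  "deg_log lam t = ((1 + t) powr lam - 1) / lam"

text \<open>The sum over \<open>n \<ge> 1\<close> is indexed here by \<open>n - 1\<close>.\<close>

definition deg_Ei :: "int \<Rightarrow> real \<Rightarrow> real \<Rightarrow> real" where
  "deg_Ei k lam x =
     (\<Sum>n. deg_falling lam 1 (Suc n) / (fact n * real (Suc n) powi k) * x ^ Suc n)"

definition poly_Bell ::
    "'a measure \<Rightarrow> ('a \<Rightarrow> real) \<Rightarrow> int \<Rightarrow> real \<Rightarrow> nat \<Rightarrow> real \<Rightarrow> real" where
  "poly_Bell M Y k lam n x =
     (if n = 0 then 1
      else egf_coeff (\<lambda>t. deg_Ei k lam (x * ((\<integral>\<omega>. deg_exp lam (Y \<omega>) t \<partial>M) - 1))) n)"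

text \<open>Signed, unlike the library's \<open>stirling\<close>.\<close>

definition Stirling1 :: "nat \<Rightarrow> nat \<Rightarrow> real" where
  "Stirling1 n k = coeff (\<Prod>i<n. [:- real i, 1:]) k"

definition deg_Stirling1 :: "real \<Rightarrow> nat \<Rightarrow> nat \<Rightarrow> real" where
  "deg_Stirling1 lam n k = egf_coeff (\<lambda>t. 1 / fact k * deg_log lam t ^ k) n"

definition prob_Stirling2 :: "'a measure \<Rightarrow> ('a \<Rightarrow> real) \<Rightarrow> nat \<Rightarrow> nat \<Rightarrow> real" where
  "prob_Stirling2 M Y n k =
     egf_coeff (\<lambda>t. 1 / fact k * ((\<integral>\<omega>. exp (Y \<omega> * t) \<partial>M) - 1) ^ k) n"

end

theory Submission
  imports Defs "HOL-Complex_Analysis.Laurent_Convergence"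
begin

text \<open>
  Near 0 the defining functions are compositions of analytic functions: \<open>E[e_\<lambda>\<^sup>Y(t)]\<close> is the moment
  generating function evaluated at \<open>L t = ln (1 + \<lambda>t) / \<lambda>\<close>, and \<open>L\<close> sends the degenerate logarithm
  of \<open>1 + t\<close> to \<open>ln (1 + t)\<close>. Hence substituting the degenerate logarithm into the generating
  function of the poly-Bell numbers gives \<open>Ei(x (E[e\<^bsup>Y s\<^esup>] - 1))\<close> at \<open>s = ln (1 + t)\<close>. Both sides
  of the identity are the \<open>n\<close>-th coefficient of this one function, expanded with the composition
  rule \<open>egf_coeff_compose\<close> in two ways.
\<close>

section \<open>Composition of real power series and of exponential generating functions\<close>

text \<open>The proof passes through the complex numbers: the coefficient embedding \<open>C\<close>
  respects products, composition and radius of convergence, so complex composition applies to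
  \<open>C F\<close> and \<open>C G\<close>, and restriction to real arguments recovers the real
  claim.\<close>

lemma has_fps_expansion_compose_real:
  fixes f g :: "real \<Rightarrow> real"
  assumes f: "f has_fps_expansion F" and g: "g has_fps_expansion G" and G0: "fps_nth G 0 = 0"
  shows "(\<lambda>t. f (g t)) has_fps_expansion (F oo G)"
proof -
  define C :: "real fps \<Rightarrow> complex fps" where "C A = Abs_fps (\<lambda>n. of_real (fps_nth A n))" for A
  have C_nth [simp]: "fps_nth (C A) n = of_real (fps_nth A n)" for A n
    by (simp add: C_def)
  have C_mult: "C (A * B) = C A * C B" for A B
    by (simp add: fps_eq_iff fps_mult_nth)
  have C_1: "C 1 = 1"
    by (simp add: fps_eq_iff)
  have C_power: "C (A ^ n) = C A ^ n" for A n
    by (induction n) (auto simp: C_mult C_1)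
  have C_compose: "C (A oo B) = (C A oo C B)" for A B
    by (simp add: fps_eq_iff fps_compose_nth flip: C_power)
  have radius: "fps_conv_radius (C A) = fps_conv_radius A" for A
    using conv_radius_norm[of "fps_nth (C A)"] conv_radius_norm[of "fps_nth A"]
    by (simp add: fps_conv_radius_def)
  have eval: "eval_fps (C A) (of_real t) = of_real (eval_fps A t)"
    if "ereal \<bar>t\<bar> < fps_conv_radius A" for A t
  proof -
    have "(\<lambda>n. fps_nth A n * t ^ n) sums eval_fps A t"
      using that by (intro sums_eval_fps) auto
    then have "(\<lambda>n. complex_of_real (fps_nth A n * t ^ n)) sums of_real (eval_fps A t)"
      by (subst sums_of_real_iff)
    then show ?thesis
      by (simp add: eval_fps_def sums_iff)
  qed
  have F: "fps_conv_radius F > 0" "eventually (\<lambda>z. eval_fps F z = f z) (nhds 0)"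
    and G: "fps_conv_radius G > 0" "eventually (\<lambda>z. eval_fps G z = g z) (nhds 0)"
    using f g by (auto simp: has_fps_expansion_def)
  have "(eval_fps (C F) \<circ> eval_fps (C G)) has_fps_expansion (C F oo C G)"
    using F(1) G(1) G0
    by (intro has_fps_expansion_compose eval_fps_has_fps_expansion) (simp_all add: radius)
  then have FG: "fps_conv_radius (F oo G) > 0"
    and ev: "eventually (\<lambda>z. eval_fps (C (F oo G)) z = eval_fps (C F) (eval_fps (C G) z)) (nhds 0)"
    by (auto simp: has_fps_expansion_def radius simp flip: C_compose)
  have ev': "eventually (\<lambda>t::real. eval_fps (C (F oo G)) (of_real t) =
      eval_fps (C F) (eval_fps (C G) (of_real t))) (nhds 0)"
    by (rule eventually_compose_filterlim[OF ev])
       (rule tendsto_eq_intros filterlim_ident | simp)+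
  have near: "eventually (\<lambda>t::real. ereal \<bar>t\<bar> < R) (nhds 0)" if "R > 0" for R
  proof -
    have "eventually (\<lambda>t::real. t \<in> eball 0 R) (nhds 0)"
      using that by (intro eventually_nhds_in_open) (auto simp: zero_ereal_def)
    then show ?thesis by (simp add: in_eball_iff)
  qed
  have g0: "g 0 = 0"
    using eventually_nhds_x_imp_x[OF G(2)] G0 by (simp add: eval_fps_at_0)
  \<comment> \<open>Continuity at 0 keeps \<open>g t\<close> inside the disc of convergence of
    \<open>F\<close>, where \<open>eval\<close> and the expansion of \<open>f\<close> apply.\<close>
  have lim: "(g \<longlongrightarrow> 0) (nhds 0)"
    using has_fps_expansion_imp_continuous[OF g, of UNIV] g0 tendsto_at_iff_tendsto_nhds[of g 0]
    by (simp add: continuous_within)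
  have "eventually (\<lambda>t. eval_fps F (g t) = f (g t)) (nhds 0)"
    and "eventually (\<lambda>t. ereal \<bar>g t\<bar> < fps_conv_radius F) (nhds 0)"
    using eventually_compose_filterlim[OF F(2) lim]
      eventually_compose_filterlim[OF near[OF F(1)] lim] by auto
  with ev' G(2) near[OF FG] near[OF G(1)]
  have "eventually (\<lambda>t. eval_fps (F oo G) t = f (g t)) (nhds 0)"
  proof eventually_elim
    case (elim t)
    then have "complex_of_real (eval_fps (F oo G) t) = of_real (f (g t))"
      by (simp add: eval)
    then show ?case by simp
  qed
  with FG show ?thesis
    by (simp add: has_fps_expansion_def)
qed

lemma egf_coeff_conv_fps_nth:
  assumes "f has_fps_expansion F"
  shows "egf_coeff f n = fact n * fps_nth F n"
proof -
  have "Abs_fps (\<lambda>n. fact n * fps_nth F n / fact n) = F"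
    by (simp add: fps_eq_iff)
  with assms have "egf_coeff f = (\<lambda>n. fact n * fps_nth F n)"
    by (intro egf_coeff_eqI) simp
  then show ?thesis by simp
qed

lemma egf_coeff_cong:
  assumes "eventually (\<lambda>t. f t = g t) (nhds 0)"
  shows "egf_coeff f = egf_coeff g"
  unfolding egf_coeff_def using has_fps_expansion_cong[OF assms refl] by simp

text \<open>In the \<open>n\<close>-th coefficient of \<open>F oo G\<close>, the factor
  \<open>fact j\<close> is moved to the coefficient of \<open>F\<close> and
  \<open>1 / fact j\<close> to \<open>G ^ j\<close>. The second factors then have exactly the shape
  by which all the Stirling numbers here are defined or characterized.\<close>

lemma egf_coeff_compose:
  assumes f: "f has_fps_expansion F" and g: "g has_fps_expansion G" and G0: "fps_nth G 0 = 0"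
  shows "egf_coeff (\<lambda>t. f (g t)) n =
    (\<Sum>j=0..n. egf_coeff f j * egf_coeff (\<lambda>t. 1 / fact j * g t ^ j) n)"
proof -
  have "egf_coeff (\<lambda>t. f (g t)) n = (\<Sum>j=0..n. fact n * (fps_nth F j * fps_nth (G ^ j) n))"
    using egf_coeff_conv_fps_nth[OF has_fps_expansion_compose_real[OF assms], of n]
    by (simp add: fps_compose_nth sum_distrib_left)
  also have "egf_coeff (\<lambda>t. 1 / fact j * g t ^ j) n = fact n * (1 / fact j * fps_nth (G ^ j) n)" for j
    by (subst egf_coeff_conv_fps_nth[of _ "fps_const (1 / fact j) * G ^ j"])
       (intro has_fps_expansion_cmult_left has_fps_expansion_power g, simp)
  then have "(\<Sum>j=0..n. fact n * (fps_nth F j * fps_nth (G ^ j) n)) =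
      (\<Sum>j=0..n. egf_coeff f j * egf_coeff (\<lambda>t. 1 / fact j * g t ^ j) n)"
    by (intro sum.cong) (auto simp: egf_coeff_conv_fps_nth[OF f])
  finally show ?thesis .
qed

text \<open>This is the form matching the sums of the theorem, which all start at 1.\<close>

lemma egf_coeff_compose_from_1:
  assumes f: "f has_fps_expansion F" and F0: "fps_nth F 0 = 0"
    and g: "g has_fps_expansion G" and G0: "fps_nth G 0 = 0"
  shows "egf_coeff (\<lambda>t. f (g t)) n =
    (\<Sum>j=1..n. egf_coeff f j * egf_coeff (\<lambda>t. 1 / fact j * g t ^ j) n)"
  unfolding egf_coeff_compose[OF f g G0]
  by (intro sum.mono_neutral_right) (auto simp: egf_coeff_conv_fps_nth[OF f] F0 not_less_eq_eq)

section \<open>Binomial and logarithmic series, Stirling numbers of the first kind\<close>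

lemma has_fps_expansion_ln_1_plus:
  "(\<lambda>t::real. ln (1 + t)) has_fps_expansion fps_ln 1"
proof (rule has_fps_expansionI)
  have "eventually (\<lambda>t::real. t \<in> ball 0 1) (nhds 0)"
    by (intro eventually_nhds_in_open) auto
  then show "eventually (\<lambda>t::real. (\<lambda>n. fps_nth (fps_ln 1) n * t ^ n) sums ln (1 + t)) (nhds 0)"
  proof eventually_elim
    case (elim t)
    \<comment> \<open>At \<open>n = 0\<close> both sides vanish, the left one because division by
      zero gives 0.\<close>
    have "- ((- t) ^ n) / real n = fps_nth (fps_ln 1) n * t ^ n" for n
      by (cases n) (auto simp: fps_ln_nth power_minus[of t])
    then show ?case
      using ln_series'[of t] elim by simp
  qed
qed

lemma has_fps_expansion_1_plus_powr:
  "(\<lambda>t::real. (1 + t) powr y) has_fps_expansion fps_binomial y"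
proof (rule has_fps_expansionI)
  have "eventually (\<lambda>t::real. t \<in> ball 0 1) (nhds 0)"
    by (intro eventually_nhds_in_open) auto
  then show "eventually (\<lambda>t::real. (\<lambda>n. fps_nth (fps_binomial y) n * t ^ n) sums (1 + t) powr y) (nhds 0)"
    by eventually_elim (use gen_binomial_real in auto)
qed

text \<open>Compare the coefficients of \<open>y ^ j\<close> in \<open>(1 + t) powr y = exp (y * ln (1 + t))\<close>.\<close>

lemma Stirling1_conv_egf_coeff:
  assumes "j \<le> n"
  shows "Stirling1 n j = egf_coeff (\<lambda>t. 1 / fact j * ln (1 + t) ^ j) n"
proof -
  define c where "c j = egf_coeff (\<lambda>t. 1 / fact j * ln (1 + t) ^ j) n" for j
  \<comment> \<open>For fixed \<open>y\<close> one coefficient is computed twice: by composition,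
    where \<open>exp (y * s)\<close> contributes \<open>y ^ j\<close>, and by the binomial series,
    which gives the falling factorial.\<close>
  have "poly (\<Prod>i<n. [:- real i, 1:]) y = poly (\<Sum>j=0..n. monom (c j) j) y" for y
  proof -
    have "(\<Sum>j=0..n. y ^ j * c j) = egf_coeff (\<lambda>t. exp (y * ln (1 + t))) n"
      unfolding c_def
      using egf_coeff_compose[OF has_fps_expansion_exp[of y] has_fps_expansion_ln_1_plus, of n]
      by (simp add: egf_coeff_conv_fps_nth[OF has_fps_expansion_exp[of y]])
    also have "eventually (\<lambda>t::real. t \<in> ball 0 1) (nhds 0)"
      by (intro eventually_nhds_in_open) auto
    then have "eventually (\<lambda>t. exp (y * ln (1 + t)) = (1 + t) powr y) (nhds (0::real))"
      by eventually_elim (auto simp: powr_def)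
    then have "egf_coeff (\<lambda>t. exp (y * ln (1 + t))) = egf_coeff (\<lambda>t. (1 + t) powr y)"
      by (rule egf_coeff_cong)
    also have "egf_coeff (\<lambda>t. (1 + t) powr y) n = (\<Prod>i<n. y - real i)"
      by (simp add: egf_coeff_conv_fps_nth[OF has_fps_expansion_1_plus_powr] gbinomial_prod_rev
          atLeast0LessThan)
    finally show ?thesis
      by (simp add: poly_prod poly_sum poly_monom mult.commute)
  qed
  then have "(\<Prod>i<n. [:- real i, 1:]) = (\<Sum>j=0..n. monom (c j) j)"
    by (intro poly_eq_poly_eq_iff[THEN iffD1]) auto
  with assms show ?thesis
    by (simp add: Stirling1_def coeff_sum c_def)
qed

section \<open>Analyticity of the moment generating function\<close>

text \<open>The exponential series may be integrated term by term, so the coefficients are moments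
  divided by factorials.\<close>

lemma has_fps_expansion_mgf:
  fixes Y :: "'a \<Rightarrow> real"
  assumes [measurable]: "Y \<in> borel_measurable M" and r: "r > 0"
    and int: "\<And>t. \<bar>t\<bar> < r \<Longrightarrow> integrable M (\<lambda>\<omega>. exp (Y \<omega> * t))"
  shows "(\<lambda>t. \<integral>\<omega>. exp (Y \<omega> * t) \<partial>M) has_fps_expansion Abs_fps (\<lambda>n. (\<integral>\<omega>. Y \<omega> ^ n \<partial>M) / fact n)"
proof (rule has_fps_expansionI)
  have "eventually (\<lambda>t::real. t \<in> ball 0 r) (nhds 0)"
    using r by (intro eventually_nhds_in_open) auto
  then show "eventually (\<lambda>t. (\<lambda>n. fps_nth (Abs_fps (\<lambda>n. (\<integral>\<omega>. Y \<omega> ^ n \<partial>M) / fact n)) n * t ^ n)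
      sums (\<integral>\<omega>. exp (Y \<omega> * t) \<partial>M)) (nhds 0)"
  proof eventually_elim
    case (elim t)
    define f where "f n \<omega> = (Y \<omega> * t) ^ n / fact n" for n \<omega>
    \<comment> \<open>\<open>B\<close> dominates \<open>exp \<bar>Y \<omega> * t\<bar>\<close>,
      hence every partial sum of norms, and is integrable because the interval of existence is
      symmetric about 0.\<close>
    define B where "B \<omega> = exp (Y \<omega> * t) + exp (Y \<omega> * (-t))" for \<omega>
    have [measurable]: "f n \<in> borel_measurable M" for n
      unfolding f_def by measurable
    have B: "integrable M B"
      unfolding B_def using elim by (intro Bochner_Integration.integrable_add int) auto
    have norm_sums: "(\<lambda>n. norm (f n \<omega>)) sums exp \<bar>Y \<omega> * t\<bar>" for \<omega>
    proof -
      have "norm (f n \<omega>) = \<bar>Y \<omega> * t\<bar> ^ n /\<^sub>R fact n" for n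
        by (simp add: f_def power_abs abs_mult divide_inverse)
      then show ?thesis
        using exp_converges[of "\<bar>Y \<omega> * t\<bar>"] by simp
    qed
    have partial: "(\<Sum>i<n. norm (f i \<omega>)) \<le> B \<omega>" for n \<omega>
    proof -
      have "(\<Sum>i<n. norm (f i \<omega>)) \<le> exp \<bar>Y \<omega> * t\<bar>"
        using norm_sums[of \<omega>] sum_le_suminf[of "\<lambda>i. norm (f i \<omega>)" "{..<n}"] by (simp add: sums_iff)
      also have "\<dots> \<le> B \<omega>"
        by (cases "Y \<omega> * t \<ge> 0") (auto simp: B_def)
      finally show ?thesis .
    qed
    have single: "norm (f n \<omega>) \<le> B \<omega>" for n \<omega>
    proof -
      have "norm (f n \<omega>) \<le> (\<Sum>i<Suc n. norm (f i \<omega>))"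
        by (simp add: sum_nonneg)
      with partial[of \<omega> "Suc n"] show ?thesis by linarith
    qed
    have f: "integrable M (f n)" for n
      by (rule Bochner_Integration.integrable_bound[OF B])
         (auto intro!: AE_I2 order.trans[OF single[unfolded real_norm_def]] abs_ge_self)
    have "(\<lambda>n. integral\<^sup>L M (f n)) sums (\<integral>\<omega>. (\<Sum>n. f n \<omega>) \<partial>M)"
    proof (rule sums_integral[OF f])
      show "AE \<omega> in M. summable (\<lambda>n. norm (f n \<omega>))"
        using norm_sums by (auto simp: sums_iff)
      show "summable (\<lambda>n. \<integral>\<omega>. norm (f n \<omega>) \<partial>M)"
      proof (rule summableI_nonneg_bounded)
        fix n
        have "(\<Sum>i<n. \<integral>\<omega>. norm (f i \<omega>) \<partial>M) = (\<integral>\<omega>. (\<Sum>i<n. norm (f i \<omega>)) \<partial>M)"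
          using f by (subst Bochner_Integration.integral_sum) auto
        also have "\<dots> \<le> integral\<^sup>L M B"
          using f B partial by (intro integral_mono Bochner_Integration.integrable_sum integrable_norm)
        finally show "(\<Sum>i<n. \<integral>\<omega>. norm (f i \<omega>) \<partial>M) \<le> integral\<^sup>L M B" .
      qed auto
    qed
    moreover have "(\<Sum>n. f n \<omega>) = exp (Y \<omega> * t)" for \<omega>
      by (simp add: f_def exp_def divide_inverse mult.commute)
    moreover have "integral\<^sup>L M (f n) = (\<integral>\<omega>. Y \<omega> ^ n \<partial>M) / fact n * t ^ n" for n
      by (simp add: f_def[abs_def] power_mult_distrib)
    ultimately show ?case by simp
  qed
qed

section \<open>Convergence of the degenerate polyexponential series\<close>

lemma fps_conv_radius_pos_if_geometric_bound:
  fixes F :: "real fps"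
  assumes "\<And>n. \<bar>fps_nth F n\<bar> \<le> K ^ n" and "K > 0"
  shows "fps_conv_radius F > 0"
proof -
  \<comment> \<open>At the point \<open>1 / (2 * K)\<close> the bound leaves a convergent geometric
    series of ratio 1/2.\<close>
  have "norm (fps_nth F n * (1 / (2 * K)) ^ n) \<le> (1 / 2) ^ n" for n
  proof -
    have "norm (fps_nth F n * (1 / (2 * K)) ^ n) = \<bar>fps_nth F n\<bar> * (1 / (2 * K)) ^ n"
      using assms(2) by (simp add: abs_mult)
    also have "\<dots> \<le> K ^ n * (1 / (2 * K)) ^ n"
      using assms by (intro mult_right_mono) auto
    also have "\<dots> = (1 / 2) ^ n"
      using assms(2) by (simp flip: power_mult_distrib)
    finally show ?thesis .
  qed
  then have "summable (\<lambda>n. fps_nth F n * (1 / (2 * K)) ^ n)"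
    by (rule summable_comparison_test'[OF summable_geometric, rotated]) simp
  from conv_radius_geI[OF this] have "fps_conv_radius F \<ge> ereal (1 / (2 * K))"
    using assms(2) by (simp add: fps_conv_radius_def)
  moreover have "ereal (1 / (2 * K)) > 0"
    using assms(2) by simp
  ultimately show ?thesis by order
qed

text \<open>Indexed by the true exponent, unlike the shifted sum in \<open>deg_Ei\<close>. Index 0
  is set to 0 separately, since for \<open>k = 0\<close> the formula would give 1 there.\<close>

definition deg_Ei_fps :: "int \<Rightarrow> real \<Rightarrow> real fps" where
  "deg_Ei_fps k lam = Abs_fps (\<lambda>n. if n = 0 then 0
     else deg_falling lam 1 n / (fact (n - 1) * real n powi k))"

text \<open>The falling factorial is at most \<open>(1 + \<bar>lam\<bar>) ^ n * fact n\<close>.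
  Division by \<open>fact (n - 1)\<close> leaves a factor \<open>n\<close>, and the power of
  \<open>n\<close> contributes at most \<open>n ^ nat \<bar>k\<bar>\<close>; bounding each
  \<open>n\<close> by \<open>2 ^ n\<close> gives the exponent \<open>Suc (nat \<bar>k\<bar>)\<close>
  of 2.\<close>

lemma deg_Ei_fps_bound:
  "\<bar>fps_nth (deg_Ei_fps k lam) n\<bar> \<le> (2 ^ Suc (nat \<bar>k\<bar>) * (1 + \<bar>lam\<bar>)) ^ n"
proof (cases n)
  case (Suc m)
  have "\<bar>deg_falling lam 1 n\<bar> \<le> (\<Prod>i<n. (1 + \<bar>lam\<bar>) * real (Suc i))"
    unfolding deg_falling_def abs_prod
  proof (intro prod_mono conjI)
    fix i
    have "\<bar>1 - real i * lam\<bar> \<le> 1 + real i * \<bar>lam\<bar>"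
      using abs_triangle_ineq4[of 1 "real i * lam"] by (simp add: abs_mult)
    also have "\<dots> \<le> (1 + \<bar>lam\<bar>) * real (Suc i)"
      by (simp add: algebra_simps)
    finally show "\<bar>1 - real i * lam\<bar> \<le> (1 + \<bar>lam\<bar>) * real (Suc i)" .
  qed auto
  also have "\<dots> = (1 + \<bar>lam\<bar>) ^ n * fact n"
    by (simp add: prod.distrib fact_prod_Suc atLeast0LessThan)
  finally have falling: "\<bar>deg_falling lam 1 n\<bar> \<le> (1 + \<bar>lam\<bar>) ^ n * fact n" .
  have "inverse (real n powi k) = real n powi (- k)"
    by (simp add: power_int_minus)
  also have "\<dots> \<le> real n powi \<bar>k\<bar>"
    using Suc by (intro power_int_increasing) auto
  also have "\<dots> = real n ^ nat \<bar>k\<bar>"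
    by (simp add: power_int_def)
  also have "\<dots> \<le> (2 ^ n) ^ nat \<bar>k\<bar>"
    by (intro power_mono of_nat_less_two_power[THEN less_imp_le]) auto
  finally have pow: "inverse (real n powi k) \<le> (2 ^ nat \<bar>k\<bar>) ^ n"
    by (simp add: mult.commute flip: power_mult)
  have "\<bar>fps_nth (deg_Ei_fps k lam) n\<bar> = \<bar>deg_falling lam 1 n\<bar> / fact m * inverse (real n powi k)"
    using Suc by (simp add: deg_Ei_fps_def abs_mult power_int_abs divide_inverse)
  also have "\<dots> \<le> ((1 + \<bar>lam\<bar>) ^ n * fact n / fact m) * (2 ^ nat \<bar>k\<bar>) ^ n"
    using falling pow by (intro mult_mono divide_right_mono) auto
  also have "fact n / fact m = real n"
    using Suc by (simp add: divide_simps)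
  then have "((1 + \<bar>lam\<bar>) ^ n * fact n / fact m) * (2 ^ nat \<bar>k\<bar>) ^ n =
      real n * ((1 + \<bar>lam\<bar>) ^ n * (2 ^ nat \<bar>k\<bar>) ^ n)"
    by (metis mult.commute mult.assoc times_divide_eq_right)
  also have "\<dots> \<le> 2 ^ n * ((1 + \<bar>lam\<bar>) ^ n * (2 ^ nat \<bar>k\<bar>) ^ n)"
    by (intro mult_right_mono of_nat_less_two_power[THEN less_imp_le]) auto
  also have "\<dots> = (2 ^ Suc (nat \<bar>k\<bar>) * (1 + \<bar>lam\<bar>)) ^ n"
    by (simp add: power_mult_distrib mult_ac)
  finally show ?thesis .
qed (simp add: deg_Ei_fps_def)

lemma has_fps_expansion_deg_Ei: "deg_Ei k lam has_fps_expansion deg_Ei_fps k lam"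
proof -
  have R: "fps_conv_radius (deg_Ei_fps k lam) > 0"
    by (rule fps_conv_radius_pos_if_geometric_bound[OF deg_Ei_fps_bound]) (auto intro: add_pos_nonneg)
  then have "eventually (\<lambda>z. z \<in> eball 0 (fps_conv_radius (deg_Ei_fps k lam))) (nhds 0)"
    by (intro eventually_nhds_in_open) (auto simp: zero_ereal_def)
  then have "eventually (\<lambda>z. eval_fps (deg_Ei_fps k lam) z = deg_Ei k lam z) (nhds 0)"
  proof eventually_elim
    case (elim z)
    then have "summable (\<lambda>n. fps_nth (deg_Ei_fps k lam) n * z ^ n)"
      by (intro summable_fps) (auto simp: in_eball_iff)
    \<comment> \<open>The head term is 0, so the series equals its shift by one index.\<close>
    from suminf_split_head[OF this] show ?case
      by (simp add: eval_fps_def deg_Ei_def deg_Ei_fps_def del: of_nat_Suc power_Suc)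
  qed
  with R show ?thesis by (simp add: has_fps_expansion_def)
qed

lemma has_fps_expansion_deg_log:
  "deg_log lam has_fps_expansion fps_const (1 / lam) * (fps_binomial lam - 1)"
proof -
  have "(\<lambda>t. 1 / lam * ((1 + t) powr lam - 1)) has_fps_expansion fps_const (1 / lam) * (fps_binomial lam - 1)"
    by (intro has_fps_expansion_cmult_left has_fps_expansion_diff has_fps_expansion_1_plus_powr
        has_fps_expansion_1)
  then show ?thesis by (simp add: deg_log_def[abs_def])
qed

section \<open>Two expansions of the same coefficient\<close>

theorem theorem2p4:
  fixes M :: "'a measure" and Y :: "'a \<Rightarrow> real" and lam r x :: real and k :: int and n :: nat
  assumes "prob_space M"
    and "Y \<in> borel_measurable M"
    and "r > 0"
    and "\<And>t. \<bar>t\<bar> < r \<Longrightarrow> integrable M (\<lambda>\<omega>. exp (Y \<omega> * t))"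
    and "lam \<noteq> 0"
    and "n \<ge> 1"
  shows "(\<Sum>l=1..n. deg_Stirling1 lam n l * poly_Bell M Y k lam l x) =
         (\<Sum>j=1..n. \<Sum>l=1..j.
            deg_falling lam 1 l / real l powi (k - 1) * prob_Stirling2 M Y j l * Stirling1 n j * x ^ l)"
proof -
  interpret prob_space M by fact
  define mgf where "mgf t = (\<integral>\<omega>. exp (Y \<omega> * t) \<partial>M) - 1" for t
  define P where "P = Abs_fps (\<lambda>n. (\<integral>\<omega>. Y \<omega> ^ n \<partial>M) / fact n) - 1"
  have mgf: "mgf has_fps_expansion P"
    unfolding mgf_def[abs_def] P_def
    by (intro has_fps_expansion_diff has_fps_expansion_mgf[OF assms(2-4)] has_fps_expansion_1)
  \<comment> \<open>The zeroth moment is the total mass 1 of the probability space.\<close>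
  have P0: "fps_nth P 0 = 0"
    by (simp add: P_def prob_space)

  define L where "L t = 1 / lam * ln (1 + lam * t)" for t
  define LF where "LF = fps_const (1 / lam) * (fps_ln 1 oo (fps_const lam * fps_X))"
  have L: "L has_fps_expansion LF" and LF0: "fps_nth LF 0 = 0"
    unfolding L_def[abs_def] LF_def
    by (intro has_fps_expansion_cmult_left has_fps_expansion_fps_X
        has_fps_expansion_compose_real[OF has_fps_expansion_ln_1_plus]) auto

  define E where "E y = deg_Ei k lam (x * y)" for y
  define EF where "EF = deg_Ei_fps k lam oo (fps_const x * fps_X)"
  have E: "E has_fps_expansion EF" and EF0: "fps_nth EF 0 = 0"
    unfolding E_def[abs_def] EF_def
    by (intro has_fps_expansion_cmult_left has_fps_expansion_fps_X
        has_fps_expansion_compose_real[OF has_fps_expansion_deg_Ei]) (auto simp: deg_Ei_fps_def)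
  \<comment> \<open>The quotient of \<open>fact l\<close> by \<open>fact (l - 1)\<close> is
    \<open>l\<close>, which lowers the exponent \<open>k\<close> to \<open>k - 1\<close>.\<close>
  have E_coeff: "egf_coeff E l = deg_falling lam 1 l / real l powi (k - 1) * x ^ l" if "l \<ge> 1" for l
  proof -
    have "fps_nth EF l = x ^ l * fps_nth (deg_Ei_fps k lam) l"
      by (simp add: EF_def fps_compose_linear)
    moreover have "fact l = real l * fact (l - 1)"
      using that by (simp add: fact_reduce)
    moreover have "real l powi k = real l * real l powi (k - 1)"
      using that by (simp add: power_int_diff)
    ultimately show ?thesis
      using that by (simp add: egf_coeff_conv_fps_nth[OF E] deg_Ei_fps_def)
  qed

  define H where "H t = E (mgf t)" for t
  have H: "H has_fps_expansion (EF oo P)" and H0: "fps_nth (EF oo P) 0 = 0"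
    unfolding H_def[abs_def] using has_fps_expansion_compose_real[OF E mgf P0] EF0 by auto
  \<comment> \<open>Expanding in powers of \<open>mgf\<close> produces the second-kind numbers and
    thus the inner sum on the right-hand side.\<close>
  have H_coeff: "egf_coeff H j = (\<Sum>l=1..j. deg_falling lam 1 l / real l powi (k - 1) * x ^ l
      * prob_Stirling2 M Y j l)" for j
    unfolding H_def[abs_def] egf_coeff_compose_from_1[OF E EF0 mgf P0]
    by (intro sum.cong) (auto simp: E_coeff prob_Stirling2_def mgf_def)

  define G where "G t = H (L t)" for t
  have G: "G has_fps_expansion (EF oo P oo LF)" and G0: "fps_nth (EF oo P oo LF) 0 = 0"
    unfolding G_def[abs_def] using has_fps_expansion_compose_real[OF H L LF0] H0 by auto
  have Bell: "poly_Bell M Y k lam l x = egf_coeff G l" if "l \<ge> 1" for l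
  proof -
    \<comment> \<open>On this ball \<open>1 + lam * t\<close> is positive, so the real power in
      \<open>deg_exp\<close> is an exponential of \<open>Y \<omega> * L t\<close>.\<close>
    have "eventually (\<lambda>t. t \<in> ball 0 (1 / \<bar>lam\<bar>)) (nhds (0::real))"
      using assms(5) by (intro eventually_nhds_in_open) auto
    then have "eventually (\<lambda>t. deg_Ei k lam (x * ((\<integral>\<omega>. deg_exp lam (Y \<omega>) t \<partial>M) - 1)) = G t) (nhds 0)"
    proof eventually_elim
      case (elim t)
      then have "\<bar>lam * t\<bar> < 1"
        using assms(5) by (simp add: abs_mult field_simps)
      then have "1 + lam * t > 0" by linarith
      then have "deg_exp lam (Y \<omega>) t = exp (Y \<omega> * L t)" for \<omega>
        by (simp add: deg_exp_def powr_def L_def)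
      then show ?case by (simp add: G_def H_def E_def mgf_def)
    qed
    from egf_coeff_cong[OF this] that show ?thesis
      by (simp add: poly_Bell_def)
  qed

  have D0: "fps_nth (fps_const (1 / lam) * (fps_binomial lam - 1)) 0 = 0"
    by simp
  have "eventually (\<lambda>t. t \<in> ball 0 1) (nhds (0::real))"
    by (intro eventually_nhds_in_open) auto
  then have "eventually (\<lambda>t. G (deg_log lam t) = H (ln (1 + t))) (nhds 0)"
  proof eventually_elim
    case (elim t)
    then have "1 + t > 0" by auto
    \<comment> \<open>Here \<open>1 + lam * deg_log lam t\<close> equals
      \<open>(1 + t) powr lam\<close>, whose logarithm is \<open>lam * ln (1 + t)\<close>.\<close>
    then have "L (deg_log lam t) = ln (1 + t)"
      using assms(5) by (simp add: L_def deg_log_def)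
    then show ?case by (simp add: G_def)
  qed
  then have key: "egf_coeff (\<lambda>t. G (deg_log lam t)) n = egf_coeff (\<lambda>t. H (ln (1 + t))) n"
    by (simp add: egf_coeff_cong)

  \<comment> \<open>Substituting \<open>deg_log\<close> into \<open>G\<close> gives the left-hand
    side; substituting \<open>ln (1 + t)\<close> into \<open>H\<close> gives the right-hand side,
    and \<open>key\<close> equates them.\<close>
  have "(\<Sum>l=1..n. deg_Stirling1 lam n l * poly_Bell M Y k lam l x) = egf_coeff (\<lambda>t. G (deg_log lam t)) n"
    unfolding egf_coeff_compose_from_1[OF G G0 has_fps_expansion_deg_log D0]
    by (intro sum.cong) (auto simp: Bell deg_Stirling1_def)
  also have "\<dots> = (\<Sum>j=1..n. egf_coeff H j * Stirling1 n j)"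
    unfolding key egf_coeff_compose_from_1[OF H H0 has_fps_expansion_ln_1_plus fps_ln_0]
    by (intro sum.cong) (auto simp: Stirling1_conv_egf_coeff)
  also have "\<dots> = (\<Sum>j=1..n. \<Sum>l=1..j.
      deg_falling lam 1 l / real l powi (k - 1) * prob_Stirling2 M Y j l * Stirling1 n j * x ^ l)"
    by (simp add: H_coeff sum_distrib_left mult_ac)
  finally show ?thesis .
qed

end
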